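(* Let $S=\langle n_1,\ldots,n_e\rangle$ be a numerical semigroup minimally generated by $n_1,\ldots,n_e$, and let $S'$ be a nice extension of $S$. Then $k[[S]]$ has maximal reduced type if and only if $k[[S']]$ has maximal reduced type.
   Context: $\mathbb{N}$ denotes the non-negative integers. A numerical semigroup is a submonoid $S$ of $(\mathbb{N},+)$ with $\mathbb{N}\setminus S$ finite; it has a unique minimal generating set, and $\langle a_1,\ldots,a_q\rangle$ denotes the submonoid generated by $a_1,\ldots,a_q$. The multiplicity $m(S)$ is the smallest nonzero element of $S$, and the Frobenius number $\mathrm{F}(S)$ is the largest integer not in $S$. A pseudo-Frobenius number of $S$ is an integer $f\notin S$ with $f+s\in S$ for all $s\in S\setminus\{0\}$; $\mathrm{PF}(S)$ is the set of these. Nice extension: a numerical semigroup $S'$ is a nice extension of $S=\langle n_1,\ldots,n_e\rangle$ if there are an element $n_{e+1}=a_1n_1+\cdots+a_en_e\in S\setminus\{n_1,\ldots,n_e\}$ (with $a_i\in\mathbb{N}$) and a positive integer $p\leq a_1+\cdots+a_e$ with $\gcd(p,n_{e+1})=1$ such that $S'=\langle pn_1,\ldots,pn_e,n_{e+1}\rangle$. Let $k$ be an algebraically closed field of characteristic zero. For $S$ with minimal generators $n_1,\ldots,n_e$, $R=k[[S]] := k[[t^{n_1},\ldots,t^{n_e}]]\subseteq k[[t]]$. The type, $\mathrm{type}(k[[S]])$, is the Cohen-Macaulay type of $k[[S]]$, which equals $|\mathrm{PF}(S)|$. With $K$ the quotient field of $R$, $\bar R$ its integral closure in $K$ and $\mathfrak{C}=(R:_K\bar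 R)$ the conductor ideal, the reduced type is $s(R)=\dim_k \frac{\mathfrak{C}+xR}{xR}$ with $x=t^{m(S)}$; it satisfies $1\le s(R)\le \mathrm{type}(R)$, and it is known to equal the number of integers in $[\mathrm{F}(S)-m(S)+1,\mathrm{F}(S)]\setminus S$. $R$ has maximal reduced type if $s(R)=\mathrm{type}(R)$. *)

theory Defs
  imports "HOL-Computational_Algebra.Computational_Algebra" "HOL.Hull"
begin

definition add_submonoid :: "nat set \<Rightarrow> bool" where
  "add_submonoid M \<longleftrightarrow> 0 \<in> M \<and> (\<forall>x\<in>M. \<forall>y\<in>M. x + y \<in> M)"

definition numerical_semigroup :: "nat set \<Rightarrow> bool" where
  "numerical_semigroup S \<longleftrightarrow> add_submonoid S \<and> finite (- S)"

definition minimally_generates :: "nat set \<Rightarrow> nat set \<Rightarrow> bool" where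
  "minimally_generates A S \<longleftrightarrow>
     finite A \<and> add_submonoid hull A = S \<and> (\<forall>B. B \<subset> A \<longrightarrow> add_submonoid hull B \<noteq> S)"

definition multiplicity_of :: "nat set \<Rightarrow> nat" where
  "multiplicity_of S = (LEAST s. s \<in> S \<and> s \<noteq> 0)"

text \<open>The set \<open>A\<close> is the set of minimal generators \<open>n\<^sub>1, \<dots>, n\<^sub>e\<close> of the semigroup being
  extended, \<open>a\<close> is the family of coefficients and \<open>N\<close> is the new generator \<open>n\<^bsub>e+1\<^esub>\<close>.\<close>

definition nice_extension :: "nat set \<Rightarrow> nat set \<Rightarrow> bool" where
  "nice_extension A S' \<longleftrightarrow>
     numerical_semigroup S' \<and>
     (\<exists>a N p. N = (\<Sum>n\<in>A. a n * n) \<and> N \<in> (add_submonoid hull A) - A \<and>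
        0 < p \<and> p \<le> (\<Sum>n\<in>A. a n) \<and> coprime p N \<and>
        S' = add_submonoid hull (insert N ((*) p ` A)))"


text \<open>All rings below are subsets of the field \<open>k((t))\<close> of formal Laurent series, which contains
  \<open>k[[t]]\<close> as the range of \<^const>\<open>fps_to_fls\<close>; the variable \<open>t\<close> is \<^const>\<open>fls_X\<close>.\<close>

definition semigroup_ring :: "nat set \<Rightarrow> 'k::field fls set" where
  "semigroup_ring S = fps_to_fls ` {F. \<forall>n. fps_nth F n \<noteq> 0 \<longrightarrow> n \<in> S}"

definition quotient_field :: "'k::field fls set \<Rightarrow> 'k fls set" where
  "quotient_field R = {f / g | f g. f \<in> R \<and> g \<in> R \<and> g \<noteq> 0}"

definition integral_closure :: "'k::field fls set \<Rightarrow> 'k fls set" where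
  "integral_closure R =
     {z \<in> quotient_field R. \<exists>P. lead_coeff P = 1 \<and> (\<forall>i. coeff P i \<in> R) \<and> poly P z = 0}"

definition conductor :: "'k::field fls set \<Rightarrow> 'k fls set" where
  "conductor R = {z \<in> quotient_field R. \<forall>y\<in>integral_closure R. z * y \<in> R}"

definition nonunits :: "'k::field fls set \<Rightarrow> 'k fls set" where
  "nonunits R = {f \<in> R. \<not> (\<exists>g\<in>R. f * g = 1)}"

definition principal :: "'k::field fls \<Rightarrow> 'k fls set \<Rightarrow> 'k fls set" where
  "principal x R = {x * r | r. r \<in> R}"

interpretation fls_vs: vector_space "\<lambda>c f. fls_const c * (f :: 'k::field fls)"
  by unfold_locales
     (simp_all add: distrib_left distrib_right mult.assoc
        flip: fls_plus_const fls_const_mult_const)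

text \<open>For \<open>k\<close>-subspaces \<open>W \<subseteq> V\<close>, the three conditions say that \<open>B\<close> is mapped injectively onto
  a \<open>k\<close>-basis of \<open>V / W\<close>. As for the dimension in the library, the value
  is \<open>0\<close> if \<open>V / W\<close> is not finite-dimensional.\<close>

definition quotient_basis :: "'k::field fls set \<Rightarrow> 'k fls set \<Rightarrow> 'k fls set \<Rightarrow> bool" where
  "quotient_basis B V W \<longleftrightarrow>
     fls_vs.independent B \<and> fls_vs.span B \<inter> W = {0} \<and>
     V = {b + w | b w. b \<in> fls_vs.span B \<and> w \<in> W}"

definition quotient_dim :: "'k::field fls set \<Rightarrow> 'k fls set \<Rightarrow> nat" where
  "quotient_dim V W = card (SOME B. quotient_basis B V W)"

text \<open>For a one-dimensional Cohen-Macaulay local ring \<open>R\<close> with residue field \<open>k\<close>, and a nonzerodivisor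
  \<open>x\<close> in its maximal ideal \<open>\<mm>\<close> (the set of nonunits), the Cohen-Macaulay type is the
  \<open>k\<close>-dimension of the socle \<open>(xR :\<^sub>R \<mm>) / xR\<close> of \<open>R / xR\<close>.\<close>

definition cm_type :: "'k::field fls set \<Rightarrow> 'k fls \<Rightarrow> nat" where
  "cm_type R x =
     quotient_dim {r \<in> R. \<forall>y\<in>nonunits R. r * y \<in> principal x R} (principal x R)"

definition reduced_type :: "'k::field fls set \<Rightarrow> 'k fls \<Rightarrow> nat" where
  "reduced_type R x =
     quotient_dim {c + z | c z. c \<in> conductor R \<and> z \<in> principal x R} (principal x R)"

definition maximal_reduced_type :: "'k::field itself \<Rightarrow> nat set \<Rightarrow> bool" where
  "maximal_reduced_type _ S \<longleftrightarrow>
     (let R = (semigroup_ring S :: 'k fls set); x = fls_X ^ multiplicity_of S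
      in reduced_type R x = cm_type R x)"


text \<open>The next two lemmas confirm that \<^const>\<open>semigroup_ring\<close> is \<open>k[[t\<^bsup>n\<^sub>1\<^esup>, \<dots>, t\<^bsup>n\<^sub>e\<^esup>]]\<close>, the image of
  \<open>k[[X\<^sub>1, \<dots>, X\<^sub>e]]\<close> under \<open>X\<^sub>i \<mapsto> t\<^bsup>n\<^sub>i\<^esup>\<close>: a family \<open>c\<close> of coefficients, indexed by exponent
  vectors \<open>\<alpha>\<close>, is sent to the series whose \<open>m\<close>-th coefficient is the sum of the \<open>c \<alpha>\<close> over the
  finitely many \<open>\<alpha>\<close> of weight \<open>m\<close>.\<close>

lemma add_submonoid_hull_eq:
  assumes "finite A"
  shows "add_submonoid hull A = {\<Sum>n\<in>A. \<alpha> n * n | \<alpha>. \<forall>n. n \<notin> A \<longrightarrow> \<alpha> n = 0}"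
proof (rule hull_unique)
  show "A \<subseteq> {\<Sum>n\<in>A. \<alpha> n * n | \<alpha>. \<forall>n. n \<notin> A \<longrightarrow> \<alpha> n = 0}"
  proof
    fix m assume m: "m \<in> A"
    have "(\<Sum>n\<in>A. (if n = m then 1 else 0) * n) = (\<Sum>n\<in>A. if n = m then n else 0)"
      by (intro sum.cong) auto
    also have "\<dots> = m" using m assms by simp
    finally show "m \<in> {\<Sum>n\<in>A. \<alpha> n * n | \<alpha>. \<forall>n. n \<notin> A \<longrightarrow> \<alpha> n = 0}"
      using m by (intro CollectI exI[of _ "\<lambda>n. if n = m then 1 else 0"]) auto
  qed
next
  have "\<exists>\<gamma>. (\<Sum>n\<in>A. \<alpha> n * n) + (\<Sum>n\<in>A. \<beta> n * n) = (\<Sum>n\<in>A. \<gamma> n * n) \<and> (\<forall>n. n \<notin> A \<longrightarrow> \<gamma> n = 0)"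
    if "\<forall>n. n \<notin> A \<longrightarrow> \<alpha> n = 0" "\<forall>n. n \<notin> A \<longrightarrow> \<beta> n = 0" for \<alpha> \<beta> :: "nat \<Rightarrow> nat"
    using that by (intro exI[of _ "\<lambda>n. \<alpha> n + \<beta> n"]) (auto simp: sum.distrib algebra_simps)
  moreover have "\<exists>\<gamma>. 0 = (\<Sum>n\<in>A. \<gamma> n * n) \<and> (\<forall>n. n \<notin> A \<longrightarrow> \<gamma> n = (0::nat))"
    by (rule exI[of _ "\<lambda>_. 0"]) simp
  ultimately show "add_submonoid {\<Sum>n\<in>A. \<alpha> n * n | \<alpha>. \<forall>n. n \<notin> A \<longrightarrow> \<alpha> n = 0}"
    unfolding add_submonoid_def by blast
next
  fix M assume M: "A \<subseteq> M" "add_submonoid M"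
  have mult: "a * n \<in> M" if "n \<in> A" for a n
    by (induction a) (use M that in \<open>auto simp: add_submonoid_def\<close>)
  have "(\<Sum>n\<in>B. \<alpha> n * n) \<in> M" if "B \<subseteq> A" for B \<alpha>
    using finite_subset[OF that assms] that
    by (induction B rule: finite_induct) (use M mult in \<open>auto simp: add_submonoid_def\<close>)
  then show "{\<Sum>n\<in>A. \<alpha> n * n | \<alpha>. \<forall>n. n \<notin> A \<longrightarrow> \<alpha> n = 0} \<subseteq> M" by blast
qed

lemma semigroup_ring_hull_eq:
  assumes "finite A" "0 \<notin> A"
  shows "(semigroup_ring (add_submonoid hull A) :: 'k::field fls set) =
    fps_to_fls ` {F. \<exists>c. \<forall>m. fps_nth F m =
      (\<Sum>\<alpha> | (\<forall>n. n \<notin> A \<longrightarrow> \<alpha> n = 0) \<and> (\<Sum>n\<in>A. \<alpha> n * n) = m. c \<alpha>)}"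
proof -
  let ?E = "\<lambda>m. {\<alpha>. (\<forall>n. n \<notin> A \<longrightarrow> \<alpha> n = 0) \<and> (\<Sum>n\<in>A. \<alpha> n * n) = m}"
  have fin: "finite (?E m)" for m
  proof (rule finite_subset)
    show "finite {\<alpha>. \<forall>n. (n \<in> A \<longrightarrow> \<alpha> n \<in> {..m}) \<and> (n \<notin> A \<longrightarrow> \<alpha> n = (0::nat))}"
      using assms by (intro finite_set_of_finite_funs) auto
    have "\<alpha> n \<le> (\<Sum>n\<in>A. \<alpha> n * n)" if "n \<in> A" for \<alpha> n
    proof -
      have "\<alpha> n \<le> \<alpha> n * n" using that assms by (cases n) auto
      also have "\<dots> \<le> (\<Sum>n\<in>A. \<alpha> n * n)"
        using member_le_sum[of n A "\<lambda>n. \<alpha> n * n"] that assms by simp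
      finally show ?thesis .
    qed
    then show "?E m \<subseteq> {\<alpha>. \<forall>n. (n \<in> A \<longrightarrow> \<alpha> n \<in> {..m}) \<and> (n \<notin> A \<longrightarrow> \<alpha> n = (0::nat))}"
      by auto
  qed
  have "(\<forall>n. fps_nth F n \<noteq> 0 \<longrightarrow> n \<in> add_submonoid hull A) \<longleftrightarrow>
      (\<exists>c. \<forall>m. fps_nth F m = (\<Sum>\<alpha>\<in>?E m. c \<alpha>))" (is "?L \<longleftrightarrow> ?R") for F :: "'k fps"
  proof
    assume L: ?L
    define r where "r = (\<lambda>m. SOME \<alpha>. \<alpha> \<in> ?E m)"
    have r: "r m \<in> ?E m" if "fps_nth F m \<noteq> 0" for m
    proof -
      have "\<exists>\<alpha>. \<alpha> \<in> ?E m" using L that by (auto simp: add_submonoid_hull_eq[OF assms(1)])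
      then show ?thesis unfolding r_def by (rule someI_ex)
    qed
    define c where "c = (\<lambda>\<alpha>. let m = (\<Sum>n\<in>A. \<alpha> n * n) in if \<alpha> = r m then fps_nth F m else 0)"
    have "fps_nth F m = (\<Sum>\<alpha>\<in>?E m. c \<alpha>)" for m
    proof -
      have "(\<Sum>\<alpha>\<in>?E m. c \<alpha>) = (\<Sum>\<alpha>\<in>?E m. if \<alpha> = r m then fps_nth F m else 0)"
        by (intro sum.cong) (auto simp: c_def Let_def)
      also have "\<dots> = (if r m \<in> ?E m then fps_nth F m else 0)"
        by (rule sum.delta[OF fin])
      also have "\<dots> = fps_nth F m"
      proof (cases "fps_nth F m = 0")
        case False
        show ?thesis by (rule if_P[OF r[OF False]])
      qed simp
      finally show ?thesis by simp
    qed
    then show ?R by blast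
  next
    assume ?R
    then obtain c where c: "\<And>m. fps_nth F m = (\<Sum>\<alpha>\<in>?E m. c \<alpha>)" by blast
    show ?L
    proof (intro allI impI)
      fix m assume "fps_nth F m \<noteq> 0"
      then have "?E m \<noteq> {}" using c[of m] by (metis sum.empty)
      then show "m \<in> add_submonoid hull A"
        by (auto simp: add_submonoid_hull_eq[OF assms(1)])
    qed
  qed
  then show ?thesis unfolding semigroup_ring_def by simp
qed

end

theory Submission
  imports Defs
begin

text \<open>
  All rings and ideals that enter the definition of the two types are spanned by powers of \<open>t\<close>:
  each of them consists of the series supported in some set of exponents, and the dimension of a
  quotient of two of them is the number of exponents in the difference
  (\<open>quotient_dim_semigroup_ring\<close>). After shifting by \<open>-m(S)\<close>, the Cohen-Macaulay type counts
  \<open>PF(S)\<close>, and the reduced type counts the gaps above \<open>F(S) - m(S)\<close>, all of which are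
  pseudo-Frobenius numbers. Hence \<open>k[[S]]\<close> has maximal reduced type iff every pseudo-Frobenius
  number exceeds \<open>F(S) - m(S)\<close>. As \<open>F(S)\<close> is the largest pseudo-Frobenius number, this means that
  any two pseudo-Frobenius numbers differ by less than \<open>m(S)\<close>
  (\<open>maximal_reduced_type_iff_pseudo_frobenius\<close>), a condition
  on \<open>S\<close> alone.

  Now let \<open>S' = pS + N\<nat>\<close> with \<open>N \<in> S\<close> prime to \<open>p\<close>. Every integer is \<open>pu + Nj\<close> for a unique integer
  \<open>u\<close> and a unique \<open>0 \<le> j < p\<close>, and it lies in \<open>S'\<close> iff \<open>u \<in> S\<close>. It follows that
  \<open>PF(S') = p PF(S) + (p - 1)N\<close>, so all differences are multiplied by \<open>p\<close>. The bound
  \<open>p \<le> a\<^sub>1 + \<dots> + a\<^sub>e\<close> gives \<open>N \<ge> p m(S)\<close>, hence \<open>m(S') = p m(S)\<close>: the multiplicity is multiplied by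
  \<open>p\<close> as well, and the condition is unchanged.
\<close>

section \<open>Series with prescribed support\<close>

text \<open>Below, \<^const>\<open>semigroup_ring\<close> is applied to arbitrary sets of exponents, in order to describe
  ideals of \<open>k[[S]]\<close> and \<open>k[[t]]\<close> itself.\<close>

lemma semigroup_ring_iff:
  "f \<in> semigroup_ring T \<longleftrightarrow> (\<forall>n. fls_nth f n \<noteq> 0 \<longrightarrow> n \<in> int ` T)"
proof
  assume "f \<in> semigroup_ring T"
  then obtain F where F: "f = fps_to_fls F" "\<And>n. fps_nth F n \<noteq> 0 \<Longrightarrow> n \<in> T"
    by (auto simp: semigroup_ring_def)
  show "\<forall>n. fls_nth f n \<noteq> 0 \<longrightarrow> n \<in> int ` T"
  proof (intro allI impI)
    fix n assume "fls_nth f n \<noteq> 0"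
    then have "n = int (nat n)" "nat n \<in> T" using F by (auto split: if_splits)
    then show "n \<in> int ` T" by blast
  qed
next
  assume supp: "\<forall>n. fls_nth f n \<noteq> 0 \<longrightarrow> n \<in> int ` T"
  have "f = fps_to_fls (fls_regpart f)"
  proof (rule fls_eqI)
    fix n show "fls_nth f n = fls_nth (fps_to_fls (fls_regpart f)) n"
      using supp by (cases "n < 0") force+
  qed
  moreover have "\<forall>n. fps_nth (fls_regpart f) n \<noteq> 0 \<longrightarrow> n \<in> T"
    using supp by auto
  ultimately show "f \<in> semigroup_ring T"
    unfolding semigroup_ring_def by blast
qed

lemma nth_semigroup_ring_eq_0: "f \<in> semigroup_ring T \<Longrightarrow> n \<notin> int ` T \<Longrightarrow> fls_nth f n = 0"
  by (auto simp: semigroup_ring_iff)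

lemma fps_to_fls_in_semigroup_ring_iff:
  "fps_to_fls F \<in> semigroup_ring T \<longleftrightarrow> (\<forall>n. fps_nth F n \<noteq> 0 \<longrightarrow> n \<in> T)"
  by (auto simp: semigroup_ring_def)

lemma semigroup_ring_mono: "T \<subseteq> U \<Longrightarrow> semigroup_ring T \<subseteq> semigroup_ring U"
  by (auto simp: semigroup_ring_def)

lemma fls_X_power_in_semigroup_ring_iff:
  "(fls_X ^ n :: 'k::field fls) \<in> semigroup_ring T \<longleftrightarrow> n \<in> T"
  by (auto simp: semigroup_ring_iff)

lemma semigroup_ring_mult:
  assumes "f \<in> semigroup_ring T" "g \<in> semigroup_ring U"
    and "\<And>a b. a \<in> T \<Longrightarrow> b \<in> U \<Longrightarrow> a + b \<in> V"
  shows "f * g \<in> semigroup_ring V"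
proof -
  obtain F G where FG: "f = fps_to_fls F" "g = fps_to_fls G"
    "\<And>n. fps_nth F n \<noteq> 0 \<Longrightarrow> n \<in> T" "\<And>n. fps_nth G n \<noteq> 0 \<Longrightarrow> n \<in> U"
    using assms(1,2) by (auto simp: semigroup_ring_def)
  have "n \<in> V" if "fps_nth (F * G) n \<noteq> 0" for n
  proof -
    obtain i where i: "i \<le> n" "fps_nth F i * fps_nth G (n - i) \<noteq> 0"
      using \<open>fps_nth (F * G) n \<noteq> 0\<close> unfolding fps_mult_nth
      by (metis (no_types, lifting) atLeastAtMost_iff sum.neutral)
    then have "i + (n - i) \<in> V" using FG(3,4) assms(3) by (metis mult_zero_left mult_zero_right)
    then show ?thesis using i by simp
  qed
  then show ?thesis
    by (simp add: FG fps_to_fls_in_semigroup_ring_iff flip: fls_times_fps_to_fls)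
qed

definition restrict_support :: "nat set \<Rightarrow> 'k::field fls \<Rightarrow> 'k fls" where
  "restrict_support T f = fps_to_fls (Abs_fps (\<lambda>n. if n \<in> T then fls_nth f (int n) else 0))"

lemma nth_restrict_support:
  "fls_nth (restrict_support T f) n = (if n \<in> int ` T then fls_nth f n else 0)"
  by (cases n) (auto simp: restrict_support_def)

lemma restrict_support_in_semigroup_ring: "restrict_support T f \<in> semigroup_ring T"
  by (auto simp: semigroup_ring_iff nth_restrict_support)

lemma semigroup_ring_Un:
  "semigroup_ring (T \<union> U) = {f + g | f g. f \<in> semigroup_ring T \<and> g \<in> semigroup_ring U}"
  (is "?L = ?R")
proof
  show "?R \<subseteq> ?L"
  proof
    fix h assume "h \<in> ?R"
    then obtain f g where h: "h = f + g" "f \<in> semigroup_ring T" "g \<in> semigroup_ring U" by blast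
    have "n \<in> int ` (T \<union> U)" if "fls_nth h n \<noteq> 0" for n
      using that h by (cases "fls_nth f n = 0") (auto simp: semigroup_ring_iff)
    then show "h \<in> ?L" by (simp add: semigroup_ring_iff)
  qed
  show "?L \<subseteq> ?R"
  proof
    fix h assume h: "h \<in> ?L"
    have "h = restrict_support T h + restrict_support (U - T) h"
    proof (rule fls_eqI)
      fix n
      show "fls_nth h n = fls_nth (restrict_support T h + restrict_support (U - T) h) n"
        using h by (cases "fls_nth h n = 0") (auto simp: nth_restrict_support semigroup_ring_iff)
    qed
    moreover have "restrict_support (U - T) h \<in> semigroup_ring U"
      using restrict_support_in_semigroup_ring semigroup_ring_mono[of "U - T" U] by blast
    ultimately show "h \<in> ?R" using restrict_support_in_semigroup_ring[of T h] by blast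
  qed
qed

section \<open>Dimensions of quotients\<close>

lemma subspace_semigroup_ring: "fls_vs.subspace (semigroup_ring T)"
proof (rule fls_vs.subspaceI)
  show "0 \<in> semigroup_ring T" by (simp add: semigroup_ring_iff)
  show "f + g \<in> semigroup_ring T" if "f \<in> semigroup_ring T" "g \<in> semigroup_ring T" for f g :: "'a fls"
    using that semigroup_ring_Un[of T T] by auto
  show "fls_const c * f \<in> semigroup_ring T" if "f \<in> semigroup_ring T" for c and f :: "'a fls"
    using that by (auto simp: semigroup_ring_iff)
qed

lemma sum_monomials_nth:
  "finite D \<Longrightarrow> fls_nth (\<Sum>n\<in>D. fls_const (c n) * fls_X ^ n) (int m) =
    (if m \<in> D then c m else (0::'k::field))"
  by (simp add: fls_nth_sum if_distrib[of "(*) _"] cong: if_cong)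

lemma inj_fls_X_power: "inj_on (\<lambda>n. fls_X ^ n :: 'k::field fls) D"
proof (rule inj_onI)
  fix m n assume "(fls_X ^ m :: 'k fls) = fls_X ^ n"
  then have "fls_nth (fls_X ^ m :: 'k fls) (int m) = fls_nth (fls_X ^ n) (int m)" by simp
  then show "m = n" by (simp split: if_splits)
qed

lemma independent_monomials:
  assumes "finite D"
  shows "fls_vs.independent ((\<lambda>n. fls_X ^ n :: 'k::field fls) ` D)"
proof (rule fls_vs.independent_if_scalars_zero)
  show "finite ((\<lambda>n. fls_X ^ n :: 'k fls) ` D)" using assms by simp
next
  fix c :: "'k fls \<Rightarrow> 'k" and x :: "'k fls"
  assume sum0: "(\<Sum>x\<in>(\<lambda>n. fls_X ^ n :: 'k fls) ` D. fls_const (c x) * x) = 0"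
    and "x \<in> (\<lambda>n. fls_X ^ n) ` D"
  then obtain m where m: "m \<in> D" "x = fls_X ^ m" by blast
  have "(\<Sum>n\<in>D. fls_const (c (fls_X ^ n)) * fls_X ^ n) = 0"
    using sum0 by (simp add: sum.reindex[OF inj_fls_X_power])
  then have "fls_nth (\<Sum>n\<in>D. fls_const (c (fls_X ^ n)) * fls_X ^ n) (int m) = 0" by simp
  then show "c x = 0" using m assms by (simp add: sum_monomials_nth)
qed

lemma span_monomials:
  assumes "finite D"
  shows "fls_vs.span ((\<lambda>n. fls_X ^ n :: 'k::field fls) ` D) = semigroup_ring D"
proof
  show "fls_vs.span ((\<lambda>n. fls_X ^ n :: 'k fls) ` D) \<subseteq> semigroup_ring D"
    by (rule fls_vs.span_minimal[OF _ subspace_semigroup_ring])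
       (auto simp: fls_X_power_in_semigroup_ring_iff)
  show "semigroup_ring D \<subseteq> fls_vs.span ((\<lambda>n. fls_X ^ n :: 'k fls) ` D)"
  proof
    fix f :: "'k fls" assume f: "f \<in> semigroup_ring D"
    have "f = (\<Sum>n\<in>D. fls_const (fls_nth f (int n)) * fls_X ^ n)" (is "_ = ?g")
    proof (rule fls_eqI)
      fix k
      have g: "?g \<in> semigroup_ring D"
        by (intro fls_vs.subspace_sum[OF subspace_semigroup_ring]
              fls_vs.subspace_scale[OF subspace_semigroup_ring])
           (simp add: fls_X_power_in_semigroup_ring_iff)
      show "fls_nth f k = fls_nth ?g k"
      proof (cases "k \<in> int ` D")
        case True
        then show ?thesis using assms by (auto simp: sum_monomials_nth)
      next
        case False
        then show ?thesis using f g unfolding semigroup_ring_iff by metis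
      qed
    qed
    also have "?g \<in> fls_vs.span ((\<lambda>n. fls_X ^ n) ` D)"
      by (intro fls_vs.span_sum fls_vs.span_scale fls_vs.span_base) auto
    finally show "f \<in> fls_vs.span ((\<lambda>n. fls_X ^ n) ` D)" .
  qed
qed

text \<open>Restricting supports to \<open>T - U\<close> is a linear map whose kernel on the series supported in \<open>T\<close>
  consists of those supported in \<open>U\<close>. So it maps any basis of the quotient bijectively onto a basis
  of the span of the monomials with exponent in \<open>T - U\<close>, which makes the cardinality
  independent of the chosen basis.\<close>

lemma quotient_dim_semigroup_ring:
  assumes "U \<subseteq> T" "finite (T - U)"
  shows "quotient_dim (semigroup_ring T :: 'k::field fls set) (semigroup_ring U) = card (T - U)"
proof -
  let ?V = "semigroup_ring T :: 'k fls set" and ?W = "semigroup_ring U :: 'k fls set"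
  let ?D = "T - U"
  let ?M = "(\<lambda>n. fls_X ^ n :: 'k fls) ` ?D"
  let ?r = "restrict_support ?D :: 'k fls \<Rightarrow> 'k fls"
  have spanM: "fls_vs.span ?M = semigroup_ring ?D" by (rule span_monomials[OF assms(2)])
  have TU: "?D \<union> U = T" using assms(1) by blast
  have lin: "Vector_Spaces.linear (\<lambda>c f. fls_const c * f) (\<lambda>c f. fls_const c * f) ?r"
    by unfold_locales (auto intro!: fls_eqI simp: nth_restrict_support distrib_left)
  have cardM: "card ?M = card ?D"
    by (rule card_image[OF inj_fls_X_power])
  have "quotient_basis ?M ?V ?W"
    unfolding quotient_basis_def
  proof (intro conjI)
    show "fls_vs.independent ?M" by (rule independent_monomials[OF assms(2)])
    show "fls_vs.span ?M \<inter> ?W = {0}"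
      unfolding spanM by (fastforce simp: semigroup_ring_iff intro!: fls_eqI)
    show "?V = {b + w | b w. b \<in> fls_vs.span ?M \<and> w \<in> ?W}"
      unfolding spanM semigroup_ring_Un[symmetric] TU ..
  qed
  moreover have "card B = card ?D" if B: "quotient_basis B ?V ?W" for B
  proof -
    have ind: "fls_vs.independent B" and tri: "fls_vs.span B \<inter> ?W = {0}"
      and V: "?V = {b + w | b w. b \<in> fls_vs.span B \<and> w \<in> ?W}"
      using B by (auto simp: quotient_basis_def)
    have W0: "?r w = 0" if "w \<in> ?W" for w
    proof (rule fls_eqI)
      show "fls_nth (?r w) n = fls_nth 0 n" for n
        using nth_semigroup_ring_eq_0[OF that, of n]
        by (cases "n \<in> int ` U") (auto simp: nth_restrict_support)
    qed
    have BV: "fls_vs.span B \<subseteq> ?V"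
    proof
      fix b assume "b \<in> fls_vs.span B"
      moreover have "b = b + 0" "0 \<in> ?W" by (simp_all add: semigroup_ring_iff)
      ultimately show "b \<in> ?V" unfolding V by blast
    qed
    have kernel: "b \<in> ?W" if "b \<in> ?V" "?r b = 0" for b
      unfolding semigroup_ring_iff
    proof (intro allI impI)
      fix n assume n: "fls_nth b n \<noteq> 0"
      then have "n \<in> int ` T" using that(1) by (simp add: semigroup_ring_iff)
      moreover have "n \<notin> int ` ?D"
        using n nth_restrict_support[of ?D b n] that(2) by auto
      ultimately show "n \<in> int ` U" by blast
    qed
    have inj: "inj_on ?r (fls_vs.span B)"
      using fls_vs.subspace_span kernel BV tri
      by (subst module_hom.inj_on_iff_eq_0[OF lin[unfolded linear_iff_module_hom]]) blast+
    have indr: "fls_vs.independent (?r ` B)"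
      by (rule module_hom.independent_injective_image
            [OF lin[unfolded linear_iff_module_hom] ind inj])
    have "fls_vs.span (?r ` B) = ?r ` fls_vs.span B"
      by (rule module_hom.span_image[OF lin[unfolded linear_iff_module_hom]])
    also have "\<dots> = fls_vs.span ?M"
    proof
      show "?r ` fls_vs.span B \<subseteq> fls_vs.span ?M"
        unfolding spanM using restrict_support_in_semigroup_ring by blast
      show "fls_vs.span ?M \<subseteq> ?r ` fls_vs.span B"
      proof
        fix f assume "f \<in> fls_vs.span ?M"
        then have f: "f \<in> semigroup_ring ?D" by (simp add: spanM)
        then have "f \<in> ?V" using semigroup_ring_mono[of ?D T] by blast
        then obtain b w where bw: "f = b + w" "b \<in> fls_vs.span B" "w \<in> ?W" using V by blast
        have "f = ?r f"
          using nth_semigroup_ring_eq_0[OF f] by (auto intro!: fls_eqI simp: nth_restrict_support)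
        also have "\<dots> = ?r b + ?r w"
          unfolding bw(1) by (rule module_hom.add[OF lin[unfolded linear_iff_module_hom]])
        also have "\<dots> = ?r b" using W0[OF bw(3)] by simp
        finally show "f \<in> ?r ` fls_vs.span B" using bw(2) by blast
      qed
    qed
    finally have "fls_vs.dim (fls_vs.span ?M) = card (?r ` B)"
      using fls_vs.dim_span_eq_card_independent[OF indr] by simp
    moreover have "fls_vs.dim (fls_vs.span ?M) = card ?M"
      by (rule fls_vs.dim_span_eq_card_independent[OF independent_monomials[OF assms(2)]])
    moreover have "card (?r ` B) = card B"
      using inj_on_subset[OF inj fls_vs.span_superset] by (rule card_image)
    ultimately show ?thesis using cardM by simp
  qed
  ultimately show ?thesis unfolding quotient_dim_def by (metis someI_ex)
qed

section \<open>Ideals of a numerical semigroup ring\<close>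

lemma add_submonoid_zero: "add_submonoid S \<Longrightarrow> 0 \<in> S"
  by (simp add: add_submonoid_def)

lemma add_submonoid_add: "add_submonoid S \<Longrightarrow> a \<in> S \<Longrightarrow> b \<in> S \<Longrightarrow> a + b \<in> S"
  by (simp add: add_submonoid_def)

lemma add_submonoid_mult: "add_submonoid S \<Longrightarrow> a \<in> S \<Longrightarrow> n * a \<in> S"
  by (induction n) (simp_all add: add_submonoid_zero add_submonoid_add)

lemma numerical_semigroup_eventually:
  assumes "numerical_semigroup S"
  shows "\<exists>b. \<forall>n\<ge>b. n \<in> S"
proof -
  obtain b where b: "\<forall>n\<in>-S. n < b"
    using assms finite_nat_set_iff_bounded by (auto simp: numerical_semigroup_def)
  then have "\<forall>n\<ge>b. n \<in> S" by (meson ComplI leD)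
  then show ?thesis by blast
qed

lemma multiplicity_of_props:
  assumes "numerical_semigroup S"
  shows "multiplicity_of S \<in> S" "multiplicity_of S > 0"
    and "\<And>s. s \<in> S \<Longrightarrow> s \<noteq> 0 \<Longrightarrow> multiplicity_of S \<le> s"
proof -
  obtain b where "\<And>n. n \<ge> b \<Longrightarrow> n \<in> S" using numerical_semigroup_eventually[OF assms] by blast
  then have "Suc b \<in> S \<and> Suc b \<noteq> 0" by simp
  from LeastI[where P = "\<lambda>s. s \<in> S \<and> s \<noteq> 0", OF this]
  show "multiplicity_of S \<in> S" "multiplicity_of S > 0" by (auto simp: multiplicity_of_def)
  show "multiplicity_of S \<le> s" if "s \<in> S" "s \<noteq> 0" for s
    unfolding multiplicity_of_def using that by (intro Least_le) auto
qed

lemma principal_semigroup_ring: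
  "principal (fls_X ^ m :: 'k::field fls) (semigroup_ring S) = semigroup_ring ((+) m ` S)"
proof
  show "principal (fls_X ^ m :: 'k fls) (semigroup_ring S) \<subseteq> semigroup_ring ((+) m ` S)"
    by (auto simp: principal_def fls_X_power_in_semigroup_ring_iff
        intro!: semigroup_ring_mult[of _ "{m}" _ S])
  show "semigroup_ring ((+) m ` S) \<subseteq> principal (fls_X ^ m :: 'k fls) (semigroup_ring S)"
  proof
    fix f :: "'k fls" assume f: "f \<in> semigroup_ring ((+) m ` S)"
    have "fls_shift (int m) f \<in> semigroup_ring S"
      unfolding semigroup_ring_iff
    proof (intro allI impI)
      fix n assume "fls_nth (fls_shift (int m) f) n \<noteq> 0"
      then have "n + int m \<in> int ` (+) m ` S" using f by (simp add: semigroup_ring_iff)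
      then show "n \<in> int ` S" by auto
    qed
    moreover have "f = fls_X ^ m * fls_shift (int m) f"
      by (simp add: fls_X_power_times_conv_shift)
    ultimately show "f \<in> principal (fls_X ^ m) (semigroup_ring S)"
      unfolding principal_def by blast
  qed
qed

text \<open>\<open>k[[t]]\<close> is integrally closed: if \<open>y\<close> has order \<open>v < 0\<close>, then in an equation
  \<open>y\<^sup>d = -(c\<^bsub>d-1\<^esub> y\<^bsup>d-1\<^esup> + \<dots> + c\<^sub>0)\<close> with \<open>c\<^sub>i\<close> in \<open>k[[t]]\<close> the left side has order \<open>dv\<close>, but the right
  side has order at least \<open>(d - 1)v\<close>.\<close>

lemma integral_over_power_series:
  fixes y :: "'k::field fls"
  assumes "lead_coeff P = 1" "\<And>i. coeff P i \<in> semigroup_ring UNIV" "poly P y = 0"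
  shows "y \<in> semigroup_ring UNIV"
proof -
  have "fls_subdegree y \<ge> 0"
  proof (rule ccontr)
    assume neg: "\<not> fls_subdegree y \<ge> 0"
    then have "y \<noteq> 0" by auto
    define d where "d = degree P"
    let ?k = "int d * fls_subdegree y"
    have low: "fls_nth (coeff P i * y ^ i) ?k = 0" if "i < d" for i
    proof (rule fls_times_nth_eq0)
      have "fls_subdegree (coeff P i) \<ge> 0"
        using assms(2)[of i] by (auto simp: semigroup_ring_def fls_subdegree_fls_to_fps_gt0)
      moreover have "fls_subdegree (y ^ i) = int i * fls_subdegree y"
        by (simp add: fls_subdegree_pow)
      moreover have "?k < int i * fls_subdegree y"
        using that neg by (simp add: mult_less_cancel_right)
      ultimately show "?k < fls_subdegree (coeff P i) + fls_subdegree (y ^ i)" by linarith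
    qed
    have "0 = fls_nth (poly P y) ?k" using assms(3) by simp
    also have "\<dots> = (\<Sum>i\<le>d. fls_nth (coeff P i * y ^ i) ?k)"
      by (simp add: poly_altdef fls_nth_sum d_def)
    also have "\<dots> = fls_nth (coeff P d * y ^ d) ?k"
      using low by (simp add: lessThan_Suc_atMost[symmetric])
    also have "\<dots> = fls_nth y (fls_subdegree y) ^ d"
      using assms(1) by (simp add: d_def)
    finally show False using \<open>y \<noteq> 0\<close> by simp
  qed
  then show ?thesis
    by (auto simp: semigroup_ring_iff image_iff)
      (metis fls_eq0_below_subdegree int_nat_eq linorder_not_le order_less_le_trans)
qed

lemma integral_closure_subset_power_series:
  "integral_closure (semigroup_ring S) \<subseteq> (semigroup_ring UNIV :: 'k::field fls set)"
  unfolding integral_closure_def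
  using integral_over_power_series semigroup_ring_mono[of S UNIV] by blast

text \<open>\<open>t\<^sup>j\<close> is a root of \<open>X\<^sup>m - t\<^bsup>mj\<^esup>\<close>.\<close>

lemma fls_X_power_in_integral_closure:
  assumes "numerical_semigroup S"
  shows "(fls_X ^ j :: 'k::field fls) \<in> integral_closure (semigroup_ring S)"
proof -
  have S: "add_submonoid S" using assms by (simp add: numerical_semigroup_def)
  define m where "m = multiplicity_of S"
  have m: "m \<in> S" "m > 0" using multiplicity_of_props[OF assms] by (auto simp: m_def)
  obtain b where b: "\<And>n. n \<ge> b \<Longrightarrow> n \<in> S" using numerical_semigroup_eventually[OF assms] by blast
  have "(fls_X ^ j :: 'k fls) = fls_X ^ (b + j) / fls_X ^ b"
    by (metis fls_X_pow_nonzero nonzero_mult_div_cancel_left power_add)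
  moreover have "(fls_X ^ (b + j) :: 'k fls) \<in> semigroup_ring S"
    "(fls_X ^ b :: 'k fls) \<in> semigroup_ring S"
    using b by (simp_all add: fls_X_power_in_semigroup_ring_iff)
  ultimately have "(fls_X ^ j :: 'k fls) \<in> quotient_field (semigroup_ring S)"
    unfolding quotient_field_def using fls_X_pow_nonzero by blast
  moreover have "\<exists>P. lead_coeff P = 1 \<and> (\<forall>i. coeff P i \<in> semigroup_ring S) \<and>
      poly P (fls_X ^ j :: 'k fls) = 0"
  proof (intro exI conjI allI)
    let ?c = "fls_X ^ (m * j) :: 'k fls"
    let ?P = "monom 1 m + [:- ?c:]"
    have deg: "degree ?P = m"
      using m(2) by (subst degree_add_eq_left) (simp_all add: degree_monom_eq)
    show "lead_coeff ?P = 1" using m(2) by (simp add: deg coeff_pCons split: nat.split)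
    show "poly ?P (fls_X ^ j) = 0"
      by (simp add: poly_monom mult.commute flip: power_mult)
    have "1 \<in> (semigroup_ring S :: 'k fls set)"
      using fls_X_power_in_semigroup_ring_iff[of 0 S] add_submonoid_zero[OF S] by simp
    moreover have "- ?c \<in> semigroup_ring S"
      using add_submonoid_mult[OF S m(1), of j]
      by (intro fls_vs.subspace_neg[OF subspace_semigroup_ring])
        (simp add: fls_X_power_in_semigroup_ring_iff mult.commute)
    moreover have "coeff ?P i = (if i = m then 1 else if i = 0 then - ?c else 0)" for i
      using m(2) by (auto simp: coeff_pCons split: nat.split)
    moreover have "0 \<in> (semigroup_ring S :: 'k fls set)" by (simp add: semigroup_ring_iff)
    ultimately show "coeff ?P i \<in> semigroup_ring S" for i by metis
  qed
  ultimately show ?thesis by (simp add: integral_closure_def)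
qed

text \<open>The integral closure contains all \<open>t\<^sup>j\<close> and lies in \<open>k[[t]]\<close>, which determines the conductor: multiplication by the powers \<open>t\<^sup>j\<close> alone already forces each exponent of \<open>z\<close> to
  have only elements of \<open>S\<close> above it.\<close>

lemma conductor_semigroup_ring:
  assumes "numerical_semigroup S"
  shows "conductor (semigroup_ring S) =
    (semigroup_ring {n. \<forall>j. n + j \<in> S} :: 'k::field fls set)" (is "?L = semigroup_ring ?C")
proof
  have one: "1 \<in> (semigroup_ring S :: 'k fls set)"
    using fls_X_power_in_semigroup_ring_iff[of 0 S] assms
    by (simp add: numerical_semigroup_def add_submonoid_def)
  show "semigroup_ring ?C \<subseteq> ?L"
  proof
    fix z :: "'k fls" assume z: "z \<in> semigroup_ring ?C"
    have "?C \<subseteq> S" by (auto dest: spec[of _ 0])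
    then have zS: "z \<in> semigroup_ring S" using z semigroup_ring_mono by blast
    have "z \<in> quotient_field (semigroup_ring S)"
      unfolding quotient_field_def
      by (rule CollectI, rule exI[of _ z], rule exI[of _ 1]) (simp add: zS one)
    moreover have "z * y \<in> semigroup_ring S" if "y \<in> integral_closure (semigroup_ring S)" for y
    proof (rule semigroup_ring_mult[OF z])
      show "y \<in> semigroup_ring UNIV" using that integral_closure_subset_power_series by blast
    qed simp
    ultimately show "z \<in> ?L" by (simp add: conductor_def)
  qed
  show "?L \<subseteq> semigroup_ring ?C"
  proof
    fix z :: "'k fls" assume z: "z \<in> ?L"
    have zj: "z * fls_X ^ j \<in> semigroup_ring S" for j
      using z fls_X_power_in_integral_closure[OF assms] by (auto simp: conductor_def)
    show "z \<in> semigroup_ring ?C"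
      unfolding semigroup_ring_iff
    proof (intro allI impI)
      fix n assume n: "fls_nth z n \<noteq> 0"
      have "n + int j \<in> int ` S" for j
      proof -
        have "fls_nth (z * fls_X ^ j) (n + int j) \<noteq> 0"
          using n by (simp add: fls_X_power_times_conv_shift)
        then show ?thesis using zj by (simp add: semigroup_ring_iff)
      qed
      note nj = this
      obtain k where k: "n = int k" using nj[of 0] by auto
      have "k + j \<in> S" for j using nj[of j] unfolding k by (auto simp flip: of_nat_add)
      then show "n \<in> int ` ?C" using k by blast
    qed
  qed
qed

text \<open>\<open>k[[S]]\<close> is local: the coefficients of the inverse of a series with nonzero constant term are
  computed recursively, which produces only exponents that are sums of exponents of the series.\<close>

lemma nonunits_semigroup_ring:
  assumes "add_submonoid S"
  shows "nonunits (semigroup_ring S) = (semigroup_ring (S - {0}) :: 'k::field fls set)"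
proof
  show "nonunits (semigroup_ring S) \<subseteq> (semigroup_ring (S - {0}) :: 'k fls set)"
  proof
    fix f :: "'k fls" assume f: "f \<in> nonunits (semigroup_ring S)"
    then obtain F where F: "f = fps_to_fls F" "\<And>n. fps_nth F n \<noteq> 0 \<Longrightarrow> n \<in> S"
      by (auto simp: nonunits_def semigroup_ring_def)
    have "fps_nth F 0 = 0"
    proof (rule ccontr)
      assume F0: "fps_nth F 0 \<noteq> 0"
      have inv: "inverse F * F = 1" by (rule inverse_mult_eq_1[OF F0])
      have "fps_nth (inverse F) n \<noteq> 0 \<longrightarrow> n \<in> S" for n
      proof (induction n rule: less_induct)
        case (less n)
        show ?case
        proof (cases "n = 0")
          case True
          then show ?thesis using add_submonoid_zero[OF assms] by simp
        next
          case False
          show ?thesis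
          proof
            assume nz: "fps_nth (inverse F) n \<noteq> 0"
            have "(\<Sum>i=0..n. fps_nth (inverse F) i * fps_nth F (n - i)) = 0"
              using inv False by (simp flip: fps_mult_nth)
            then have "(\<Sum>i<n. fps_nth (inverse F) i * fps_nth F (n - i)) \<noteq> 0"
              using nz F0 by (auto simp: atLeast0AtMost lessThan_Suc_atMost[symmetric])
            then obtain i where i: "i < n" "fps_nth (inverse F) i * fps_nth F (n - i) \<noteq> 0"
              by (metis (no_types, lifting) lessThan_iff sum.neutral)
            then have "i \<in> S" "n - i \<in> S" using less.IH F(2) by auto
            then show "n \<in> S" using add_submonoid_add[OF assms, of i "n - i"] i(1) by simp
          qed
        qed
      qed
      then have "fps_to_fls (inverse F) \<in> semigroup_ring S"
        by (simp add: fps_to_fls_in_semigroup_ring_iff)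
      moreover have "f * fps_to_fls (inverse F) = 1"
        using inv by (simp add: F(1) mult.commute flip: fls_times_fps_to_fls)
      ultimately show False using f by (auto simp: nonunits_def)
    qed
    then show "f \<in> semigroup_ring (S - {0})"
      using F by (auto simp: fps_to_fls_in_semigroup_ring_iff intro!: gr0I)
  qed
  show "semigroup_ring (S - {0}) \<subseteq> (nonunits (semigroup_ring S) :: 'k fls set)"
  proof
    fix f :: "'k fls" assume f: "f \<in> semigroup_ring (S - {0})"
    have "f * g \<noteq> 1" if "g \<in> semigroup_ring S" for g
    proof
      assume "f * g = 1"
      moreover have "f * g \<in> semigroup_ring (- {0})"
        by (rule semigroup_ring_mult[OF f that]) auto
      ultimately show False using fls_X_power_in_semigroup_ring_iff[of 0 "- {0}"] by force
    qed
    then show "f \<in> nonunits (semigroup_ring S)"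
      using f semigroup_ring_mono[of "S - {0}" S] by (auto simp: nonunits_def)
  qed
qed

text \<open>The monomials \<open>t\<^sup>s\<close> with \<open>0 \<noteq> s \<in> S\<close> suffice as test elements: multiplication by one of them
  only shifts the support, so no cancellation can hide an exponent.\<close>

lemma socle_semigroup_ring:
  assumes "add_submonoid S"
  shows "{r \<in> semigroup_ring S. \<forall>y\<in>nonunits (semigroup_ring S).
      r * y \<in> principal (fls_X ^ m) (semigroup_ring S)} =
    (semigroup_ring {n \<in> S. \<forall>s\<in>S - {0}. n + s \<in> (+) m ` S} :: 'k::field fls set)"
    (is "?L = semigroup_ring ?T")
  unfolding principal_semigroup_ring nonunits_semigroup_ring[OF assms]
proof (intro set_eqI iffI)
  fix r :: "'k fls" assume "r \<in> semigroup_ring ?T"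
  then show "r \<in> {r \<in> semigroup_ring S. \<forall>y\<in>semigroup_ring (S - {0}).
      r * y \<in> semigroup_ring ((+) m ` S)}"
    using semigroup_ring_mono[of ?T S] by (auto intro: semigroup_ring_mult[of _ ?T _ "S - {0}"])
next
  fix r :: "'k fls" assume r: "r \<in> {r \<in> semigroup_ring S. \<forall>y\<in>semigroup_ring (S - {0}).
      r * y \<in> semigroup_ring ((+) m ` S)}"
  show "r \<in> semigroup_ring ?T"
    unfolding semigroup_ring_iff
  proof (intro allI impI)
    fix n assume n: "fls_nth r n \<noteq> 0"
    then obtain k where k: "n = int k" "k \<in> S" using r by (auto simp: semigroup_ring_iff)
    have "k + s \<in> (+) m ` S" if "s \<in> S - {0}" for s
    proof -
      have "r * fls_X ^ s \<in> semigroup_ring ((+) m ` S)"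
        using r that fls_X_power_in_semigroup_ring_iff by blast
      moreover have "fls_nth (r * fls_X ^ s) (int (k + s)) \<noteq> 0"
        using n k by (simp add: fls_X_power_times_conv_shift)
      ultimately have "int (k + s) \<in> int ` (+) m ` S" unfolding semigroup_ring_iff by blast
      then show ?thesis by (metis imageE of_nat_eq_iff)
    qed
    then show "n \<in> int ` ?T" using k by blast
  qed
qed

section \<open>Maximal reduced type in terms of pseudo-Frobenius numbers\<close>

text \<open>Pseudo-Frobenius numbers are integers because \<open>PF(\<nat>) = {-1}\<close>.\<close>

definition pseudo_frobenius :: "nat set \<Rightarrow> int set" where
  "pseudo_frobenius S = {f. f \<notin> int ` S \<and> (\<forall>s\<in>S - {0}. f + int s \<in> int ` S)}"

lemma int_image_add:
  "add_submonoid S \<Longrightarrow> a \<in> int ` S \<Longrightarrow> b \<in> int ` S \<Longrightarrow> a + b \<in> int ` S"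
  by (auto simp: add_submonoid_add simp flip: of_nat_add)

text \<open>The witness is the largest gap, the Frobenius number: adding a positive element to it leaves
  the gaps.\<close>

lemma le_pseudo_frobenius:
  assumes "numerical_semigroup S" "z \<notin> int ` S"
  obtains g where "g \<in> pseudo_frobenius S" "z \<le> g"
proof -
  obtain b where b: "\<And>n. n \<ge> b \<Longrightarrow> n \<in> S" using numerical_semigroup_eventually[OF assms(1)] by blast
  let ?G = "{g. g \<notin> int ` S \<and> z \<le> g}"
  have "g < int b" if "g \<notin> int ` S" for g
  proof (rule ccontr)
    assume "\<not> g < int b"
    then have "g = int (nat g)" "nat g \<in> S" using b by auto
    then show False using that by blast
  qed
  then have "?G \<subseteq> {z..int b}" by force
  then have fin: "finite ?G" by (rule finite_subset) simp
  have ne: "?G \<noteq> {}" using assms(2) by blast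
  define g where "g = Max ?G"
  have g: "g \<notin> int ` S" "z \<le> g" using Max_in[OF fin ne] by (auto simp: g_def)
  have "g + int s \<in> int ` S" if "s \<in> S - {0}" for s
  proof (rule ccontr)
    assume "g + int s \<notin> int ` S"
    then have "g + int s \<le> g" using g Max_ge[OF fin, of "g + int s"] by (simp add: g_def)
    then show False using that by simp
  qed
  then have "g \<in> pseudo_frobenius S" using g(1) by (simp add: pseudo_frobenius_def)
  then show ?thesis using g(2) that by blast
qed

text \<open>The exponents counted by the reduced type are among those counted by the Cohen-Macaulay type,
  so the two types agree iff every socle exponent \<open>f + m\<close>, with \<open>f\<close> pseudo-Frobenius, lies
  in the conductor. If it does not, then some \<open>f + m + j\<close> is a gap, and a pseudo-Frobenius number
  \<open>g \<ge> f + m + j\<close> violates the bound; conversely, any pseudo-Frobenius number \<open>g \<ge> f + m\<close> is itself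
  such a gap.\<close>

lemma maximal_reduced_type_iff_pseudo_frobenius:
  assumes "numerical_semigroup S"
  shows "maximal_reduced_type TYPE('k::field) S \<longleftrightarrow>
    (\<forall>f\<in>pseudo_frobenius S. \<forall>g\<in>pseudo_frobenius S. g - f < int (multiplicity_of S))"
proof -
  have S: "add_submonoid S" using assms by (simp add: numerical_semigroup_def)
  define m where "m = multiplicity_of S"
  have m: "m \<in> S" "m > 0" "\<And>s. s \<in> S \<Longrightarrow> s \<noteq> 0 \<Longrightarrow> m \<le> s"
    using multiplicity_of_props[OF assms] by (auto simp: m_def)
  define C where "C = {n. \<forall>j. n + j \<in> S}"
  define T where "T = {n \<in> S. \<forall>s\<in>S - {0}. n + s \<in> (+) m ` S}"
  define U where "U = (+) m ` S"
  have mem_U: "n \<in> U \<longleftrightarrow> int n - int m \<in> int ` S" for n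
    by (auto simp: U_def image_iff) (metis add.commute of_nat_add of_nat_eq_iff diff_add_cancel)
  have "finite (- U)"
  proof -
    obtain b where b: "\<And>n. n \<ge> b \<Longrightarrow> n \<in> S" using numerical_semigroup_eventually[OF assms] by blast
    have "n < b + m" if "n \<notin> U" for n
      using that b[of "n - m"] by (force simp: U_def image_iff)
    then have "- U \<subseteq> {..<b + m}" by auto
    then show ?thesis by (rule finite_subset) simp
  qed
  then have fin: "finite (X - U)" for X by (rule finite_subset[rotated]) auto
  have UT: "U \<subseteq> T"
    using add_submonoid_add[OF S] m(1) by (auto simp: U_def T_def add.assoc)
  have CT: "C \<subseteq> T"
  proof
    fix n assume n: "n \<in> C"
    have "n + s \<in> (+) m ` S" if "s \<in> S - {0}" for s
    proof -
      have "n + (s - m) \<in> S" using n unfolding C_def by blast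
      moreover have "n + s = m + (n + (s - m))" using m(3)[of s] that by simp
      ultimately show ?thesis by blast
    qed
    moreover have "n \<in> S" using n by (auto simp: C_def dest: spec[of _ 0])
    ultimately show "n \<in> T" by (auto simp: T_def)
  qed
  have "reduced_type (semigroup_ring S :: 'k fls set) (fls_X ^ m) = card ((C \<union> U) - U)"
    unfolding reduced_type_def conductor_semigroup_ring[OF assms] principal_semigroup_ring
      semigroup_ring_Un[symmetric]
    using fin by (simp add: quotient_dim_semigroup_ring C_def U_def)
  moreover have "cm_type (semigroup_ring S :: 'k fls set) (fls_X ^ m) = card (T - U)"
    unfolding cm_type_def socle_semigroup_ring[OF S] unfolding principal_semigroup_ring
    using quotient_dim_semigroup_ring[OF UT fin] by (simp add: T_def U_def)
  moreover have "card ((C \<union> U) - U) = card (T - U) \<longleftrightarrow> T - U \<subseteq> C"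
  proof -
    have "(C \<union> U) - U \<subseteq> T - U" using CT by blast
    then have "card ((C \<union> U) - U) = card (T - U) \<longleftrightarrow> (C \<union> U) - U = T - U"
      using card_subset_eq[OF fin[of T]] by metis
    also have "\<dots> \<longleftrightarrow> T - U \<subseteq> C" using CT by blast
    finally show ?thesis .
  qed
  moreover have "T - U \<subseteq> C \<longleftrightarrow>
      (\<forall>f\<in>pseudo_frobenius S. \<forall>g\<in>pseudo_frobenius S. g - f < int m)" (is "_ \<longleftrightarrow> ?R")
  proof
    assume sub: "T - U \<subseteq> C"
    show ?R
    proof (intro ballI, rule ccontr)
      fix f g assume f: "f \<in> pseudo_frobenius S" and g: "g \<in> pseudo_frobenius S"
        and "\<not> g - f < int m"
      have "f + int m \<in> int ` S" using f m(1,2) by (auto simp: pseudo_frobenius_def)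
      then obtain n where n: "f + int m = int n" "n \<in> S" by blast
      have "n \<in> T"
        unfolding T_def U_def[symmetric]
      proof (intro CollectI conjI ballI)
        fix s assume "s \<in> S - {0}"
        then have "f + int s \<in> int ` S" using f by (auto simp: pseudo_frobenius_def)
        moreover have "int (n + s) - int m = f + int s" using n by simp
        ultimately show "n + s \<in> U" by (simp only: mem_U)
      qed (rule n(2))
      moreover have "int n - int m = f" using n by simp
      then have "n \<notin> U" using f by (simp add: mem_U pseudo_frobenius_def)
      ultimately have "n \<in> C" using sub by blast
      then have "n + nat (g - f - int m) \<in> S" by (simp add: C_def)
      moreover have "g = int (n + nat (g - f - int m))" using n \<open>\<not> g - f < int m\<close> by simp
      ultimately have "g \<in> int ` S" by blast
      then show False using g by (simp add: pseudo_frobenius_def)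
    qed
  next
    assume R: ?R
    show "T - U \<subseteq> C"
    proof
      fix n assume n: "n \<in> T - U"
      have f: "int n - int m \<in> pseudo_frobenius S"
        unfolding pseudo_frobenius_def
      proof (intro CollectI conjI ballI)
        show "int n - int m \<notin> int ` S" using n mem_U by blast
        fix s assume "s \<in> S - {0}"
        then have "n + s \<in> U" using n by (auto simp: T_def U_def)
        then show "int n - int m + int s \<in> int ` S" by (simp add: mem_U algebra_simps)
      qed
      show "n \<in> C"
      proof (rule ccontr)
        assume "n \<notin> C"
        then obtain j where "n + j \<notin> S" by (auto simp: C_def)
        then have "int (n + j) \<notin> int ` S" by (metis imageE of_nat_eq_iff)
        then obtain g where g: "g \<in> pseudo_frobenius S" "int (n + j) \<le> g"
          using le_pseudo_frobenius[OF assms] by blast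
        have "g - (int n - int m) < int m" using R f g(1) by blast
        then show False using g(2) by simp
      qed
    qed
  qed
  ultimately show ?thesis by (simp add: maximal_reduced_type_def Let_def m_def)
qed

section \<open>Nice extensions\<close>

lemma add_submonoid_hull: "add_submonoid (add_submonoid hull B)"
  by (rule hull_in) (auto simp: add_submonoid_def)

text \<open>The generators \<open>pn\<close> for \<open>n \<in> A\<close> contribute the multiples by \<open>p\<close> of the whole monoid generated
  by \<open>A\<close>, so that the semigroup depends on \<open>A\<close> only through that monoid.\<close>

lemma hull_insert_scaled:
  "add_submonoid hull (insert N ((*) p ` A)) =
    {p * s + i * N | s i. s \<in> add_submonoid hull A}" (is "_ = ?M")
proof (rule hull_unique)
  let ?S = "add_submonoid hull A"
  have S: "add_submonoid ?S" by (rule add_submonoid_hull)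
  have "N = p * 0 + 1 * N" by simp
  then have "N \<in> ?M" using add_submonoid_zero[OF S] by blast
  moreover have "p * n \<in> ?M" if "n \<in> A" for n
  proof -
    have "p * n = p * n + 0 * N" by simp
    then show ?thesis using hull_inc[of n A add_submonoid, OF that] by blast
  qed
  ultimately show "insert N ((*) p ` A) \<subseteq> ?M" by blast
  have "x + y \<in> ?M" if xy: "x \<in> ?M" "y \<in> ?M" for x y
  proof -
    obtain s i s' i' where *: "x = p * s + i * N" "y = p * s' + i' * N" "s \<in> ?S" "s' \<in> ?S"
      using xy by blast
    have "x + y = p * (s + s') + (i + i') * N" by (simp add: * algebra_simps)
    then show ?thesis using add_submonoid_add[OF S *(3,4)] by blast
  qed
  moreover have "0 \<in> ?M"
  proof -
    have "0 = p * 0 + 0 * N" by simp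
    then show ?thesis using add_submonoid_zero[OF S] by blast
  qed
  ultimately show "add_submonoid ?M" unfolding add_submonoid_def by blast
next
  let ?S = "add_submonoid hull A"
  fix M assume M: "insert N ((*) p ` A) \<subseteq> M" "add_submonoid M"
  have "?S \<subseteq> {s. p * s \<in> M}"
    using M by (intro hull_minimal) (auto simp: add_submonoid_def distrib_left)
  then show "?M \<subseteq> M"
    using M add_submonoid_add[OF M(2)] add_submonoid_mult[OF M(2)] by auto
qed

lemma zero_notin_minimal_generators:
  assumes "minimally_generates A S"
  shows "0 \<notin> A"
proof
  assume "0 \<in> A"
  then have "A - {0} \<subset> A" by blast
  then have "add_submonoid hull (A - {0}) \<noteq> S"
    using assms by (simp add: minimally_generates_def)
  moreover have "add_submonoid hull (insert 0 (A - {0})) = add_submonoid hull (A - {0})"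
    by (rule hull_redundant) (rule add_submonoid_zero[OF add_submonoid_hull])
  moreover have "insert 0 (A - {0}) = A" using \<open>0 \<in> A\<close> by blast
  moreover have "add_submonoid hull A = S" using assms unfolding minimally_generates_def by blast
  ultimately show False by metis
qed

locale coprime_gluing =
  fixes S S' :: "nat set" and p N :: nat
  assumes S: "numerical_semigroup S" and S': "numerical_semigroup S'"
    and N: "N \<in> S" "N \<noteq> 0" and p: "p > 0" and coprime: "coprime p N"
    and gluing: "S' = {p * s + i * N | s i. s \<in> S}"
begin

lemma submonoid: "add_submonoid S"
  using S by (simp add: numerical_semigroup_def)

lemma gluingI: "s \<in> S \<Longrightarrow> p * s + i * N \<in> S'"
  by (auto simp: gluing)

lemma int_decomposition:
  obtains u j where "z = int p * u + int j * int N" "j < p"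
proof -
  have "coprime (int p) (int N)" using coprime by simp
  then obtain x y where xy: "x * int p + y * int N = 1"
    using bezout_int[of "int p" "int N"] by (auto simp: coprime_iff_gcd_eq_1)
  define j where "j = nat ((z * y) mod int p)"
  have j: "int j = (z * y) mod int p" "j < p"
    using p by (auto simp: j_def nat_less_iff)
  have "z = z * (x * int p + y * int N)" by (simp add: xy)
  also have "\<dots> = int p * (z * x) + (z * y) * int N" by (simp add: algebra_simps)
  also have "z * y = int p * ((z * y) div int p) + int j" by (simp add: j(1))
  finally have "z = int p * (z * x + (z * y) div int p * int N) + int j * int N"
    by (simp add: algebra_simps)
  then show ?thesis using j(2) that by blast
qed

text \<open>A representation \<open>ps + iN\<close> of an element of \<open>S'\<close> is brought into the normal form \<open>j < p\<close> by
  trading \<open>p\<close> copies of \<open>N\<close> for the element \<open>N\<close> of \<open>S\<close> in the first summand.\<close>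

lemma gluing_iff:
  assumes "j < p"
  shows "int p * u + int j * int N \<in> int ` S' \<longleftrightarrow> u \<in> int ` S"
proof
  assume "u \<in> int ` S"
  then obtain s where "s \<in> S" "u = int s" by blast
  then have "p * s + j * N \<in> S'" "int p * u + int j * int N = int (p * s + j * N)"
    by (auto intro: gluingI)
  then show "int p * u + int j * int N \<in> int ` S'" by blast
next
  assume "int p * u + int j * int N \<in> int ` S'"
  then obtain s i where s: "s \<in> S" and eq: "int p * u + int j * int N = int (p * s + i * N)"
    unfolding gluing by blast
  have eq': "int p * (u - int s) = (int i - int j) * int N"
    using eq by (simp add: algebra_simps)
  then have "int p dvd (int i - int j) * int N" by (metis dvd_triv_left)
  then have "int p dvd int i - int j"
    using coprime by (simp add: coprime_dvd_mult_left_iff)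
  then obtain q where q: "int i - int j = int p * q" by (elim dvdE)
  have "q \<ge> 0"
  proof (rule ccontr)
    assume "\<not> q \<ge> 0"
    then have "int p * q \<le> int p * (-1)" by (intro mult_left_mono) auto
    then show False using q assms by simp
  qed
  have "int p * (u - int s) = int p * (q * int N)" using eq' q by simp
  then have "u - int s = q * int N" using p by simp
  then have "u = int (s + nat q * N)" using \<open>q \<ge> 0\<close> by simp
  moreover have "s + nat q * N \<in> S"
    by (intro add_submonoid_add[OF submonoid s] add_submonoid_mult[OF submonoid N(1)])
  ultimately show "u \<in> int ` S" by blast
qed

text \<open>Adding \<open>N\<close> to \<open>pu + jN\<close> with \<open>j < p - 1\<close> does not change \<open>u\<close>, so it cannot lead from outside
  \<open>S'\<close> into \<open>S'\<close>. Therefore only \<open>j = p - 1\<close> contributes pseudo-Frobenius numbers; there, adding \<open>N\<close>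
  replaces \<open>u\<close> by \<open>u + N\<close>, just as adding \<open>pN\<close> does.\<close>

lemma pseudo_frobenius_gluing:
  "pseudo_frobenius S' = (\<lambda>u. int p * u + int (p - 1) * int N) ` pseudo_frobenius S"
proof
  have S'_p: "p * s \<in> S'" if "s \<in> S" for s
    using gluingI[OF that, of 0] by simp
  have S'_N: "N \<in> S'"
    using gluingI[of 0 1] add_submonoid_zero[OF submonoid] by simp
  show "pseudo_frobenius S' \<subseteq> (\<lambda>u. int p * u + int (p - 1) * int N) ` pseudo_frobenius S"
  proof
    fix f assume f: "f \<in> pseudo_frobenius S'"
    obtain u j where uj: "f = int p * u + int j * int N" "j < p" using int_decomposition .
    have u: "u \<notin> int ` S" using f gluing_iff[OF uj(2)] by (simp add: uj(1) pseudo_frobenius_def)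
    have "j = p - 1"
    proof (rule ccontr)
      assume "j \<noteq> p - 1"
      then have "Suc j < p" using uj(2) by simp
      have "f + int N \<in> int ` S'" using f S'_N N(2) by (auto simp: pseudo_frobenius_def)
      then have "int p * u + int (Suc j) * int N \<in> int ` S'" by (simp add: uj(1) algebra_simps)
      then show False using gluing_iff[OF \<open>Suc j < p\<close>] u by blast
    qed
    moreover have "u + int s \<in> int ` S" if "s \<in> S - {0}" for s
    proof -
      have "p * s \<in> S' - {0}" using S'_p[of s] that p by auto
      then have "f + int (p * s) \<in> int ` S'" using f unfolding pseudo_frobenius_def by blast
      then have "int p * (u + int s) + int j * int N \<in> int ` S'"
        by (simp add: uj(1) algebra_simps)
      then show ?thesis using gluing_iff[OF uj(2)] by blast
    qed
    then have "u \<in> pseudo_frobenius S" using u by (simp add: pseudo_frobenius_def)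
    ultimately show "f \<in> (\<lambda>u. int p * u + int (p - 1) * int N) ` pseudo_frobenius S"
      using uj(1) by blast
  qed
  show "(\<lambda>u. int p * u + int (p - 1) * int N) ` pseudo_frobenius S \<subseteq> pseudo_frobenius S'"
  proof (rule image_subsetI)
    fix u assume u: "u \<in> pseudo_frobenius S"
    have "p - 1 < p" using p by simp
    show "int p * u + int (p - 1) * int N \<in> pseudo_frobenius S'"
      unfolding pseudo_frobenius_def
    proof (intro CollectI conjI ballI)
      show "int p * u + int (p - 1) * int N \<notin> int ` S'"
        using u gluing_iff[OF \<open>p - 1 < p\<close>] by (simp add: pseudo_frobenius_def)
      fix t assume t: "t \<in> S' - {0}"
      obtain v j where vj: "int t = int p * v + int j * int N" "j < p" using int_decomposition .
      have "int p * v + int j * int N \<in> int ` S'" using t vj(1) by force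
      then have v: "v \<in> int ` S" using gluing_iff[OF vj(2)] by blast
      show "int p * u + int (p - 1) * int N + int t \<in> int ` S'"
      proof (cases "j = 0")
        case True
        obtain s where s: "s \<in> S" "v = int s" using v by blast
        then have "s \<in> S - {0}" using True vj(1) t by (auto intro!: gr0I)
        then have "u + v \<in> int ` S" using u s(2) by (simp add: pseudo_frobenius_def)
        then have "int p * (u + v) + int (p - 1) * int N \<in> int ` S'"
          using gluing_iff[OF \<open>p - 1 < p\<close>] by blast
        then show ?thesis using True vj(1) by (simp add: algebra_simps)
      next
        case False
        have "u + int N \<in> int ` S" using u N by (simp add: pseudo_frobenius_def)
        then have "u + int N + v \<in> int ` S" using int_image_add[OF submonoid _ v] by blast
        moreover have "j - 1 < p" using vj(2) by simp
        ultimately have "int p * (u + int N + v) + int (j - 1) * int N \<in> int ` S'"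
          using gluing_iff by blast
        moreover have "int (j - 1) = int j - 1" "int (p - 1) = int p - 1" using False p by auto
        ultimately show ?thesis by (simp add: vj(1) algebra_simps)
      qed
    qed
  qed
qed

lemma multiplicity_gluing:
  assumes "p * multiplicity_of S \<le> N"
  shows "multiplicity_of S' = p * multiplicity_of S"
proof (rule antisym)
  note m = multiplicity_of_props[OF S]
  note m' = multiplicity_of_props[OF S']
  have "p * multiplicity_of S \<in> S'"
    using gluingI[OF m(1), of 0] by simp
  then show "multiplicity_of S' \<le> p * multiplicity_of S" using m(2) p m'(3) by simp
  obtain s i where si: "multiplicity_of S' = p * s + i * N" "s \<in> S"
    using m'(1) by (auto simp: gluing)
  show "p * multiplicity_of S \<le> multiplicity_of S'"
  proof (cases "s = 0")
    case True
    then have "i \<ge> 1" using m'(2) si(1) by (cases i) auto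
    then have "N \<le> i * N" by simp
    then show ?thesis using assms si(1) by linarith
  next
    case False
    then have "p * multiplicity_of S \<le> p * s" using m(3)[OF si(2)] by simp
    then show ?thesis using si(1) by linarith
  qed
qed

lemma maximal_reduced_type_gluing:
  assumes "p * multiplicity_of S \<le> N"
  shows "maximal_reduced_type TYPE('k::field) S' \<longleftrightarrow> maximal_reduced_type TYPE('k) S"
proof -
  have "(int p * g + c) - (int p * f + c) < int p * m \<longleftrightarrow> g - f < m" for f g c m :: int
  proof -
    have "(int p * g + c) - (int p * f + c) = int p * (g - f)" by (simp add: algebra_simps)
    then show ?thesis using p by (simp only: mult_less_cancel_left_pos of_nat_0_less_iff)
  qed
  then show ?thesis
    unfolding maximal_reduced_type_iff_pseudo_frobenius[OF S]
      maximal_reduced_type_iff_pseudo_frobenius[OF S']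
      pseudo_frobenius_gluing multiplicity_gluing[OF assms]
    by simp
qed

end

theorem corollary4p7:
  fixes S S' A :: "nat set"
  assumes "numerical_semigroup S"
    and "minimally_generates A S"
    and "nice_extension A S'"
  shows "maximal_reduced_type TYPE('k::{alg_closed_field, field_char_0}) S \<longleftrightarrow>
         maximal_reduced_type TYPE('k) S'"
proof -
  have hull: "add_submonoid hull A = S"
    using assms(2) by (auto simp: minimally_generates_def)
  obtain a N p where N: "N = (\<Sum>n\<in>A. a n * n)" "N \<in> S"
    and p: "0 < p" "p \<le> (\<Sum>n\<in>A. a n)" "coprime p N"
    and S': "numerical_semigroup S'" "S' = add_submonoid hull (insert N ((*) p ` A))"
    using assms(3) unfolding nice_extension_def hull by blast
  note m = multiplicity_of_props[OF assms(1)]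
  have ge: "multiplicity_of S \<le> n" if "n \<in> A" for n
  proof (rule m(3))
    show "n \<in> S" using hull_inc[OF that, of add_submonoid] hull by simp
    show "n \<noteq> 0" using that zero_notin_minimal_generators[OF assms(2)] by metis
  qed
  have "p * multiplicity_of S \<le> (\<Sum>n\<in>A. a n) * multiplicity_of S" using p(2) by simp
  also have "\<dots> = (\<Sum>n\<in>A. a n * multiplicity_of S)" by (rule sum_distrib_right)
  also have "\<dots> \<le> N" unfolding N(1) using ge by (intro sum_mono) simp
  finally have le: "p * multiplicity_of S \<le> N" .
  moreover have "p * multiplicity_of S > 0" using p(1) m(2) by simp
  ultimately have "N \<noteq> 0" by linarith
  interpret coprime_gluing S S' p N
    using assms(1) S' N(2) \<open>N \<noteq> 0\<close> p(1,3) hull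
    by unfold_locales (simp_all add: hull_insert_scaled)
  show ?thesis by (rule maximal_reduced_type_gluing[OF le, symmetric])
qed

end
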